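(* Let $\mathbf{K}=(K_1,\dots,K_n)\in\mathcal{S}_0^n$. For $\vec{\phi}=(\phi_1,\dots,\phi_n)\in\widetilde{\Phi}^n\cup\widetilde{\Psi}^n$, $$\big[\widetilde{\Omega}_{\vec\phi}^{orlicz}(\mathbf{K})\big]^n\leq\prod_{i=1}^n\widetilde{\Omega}_{\phi_i}^{orlicz}(K_i)\quad\text{and}\quad\big[\widetilde{G}_{\vec\phi}^{orlicz}(\mathbf{K})\big]^n\leq\prod_{i=1}^n\widetilde{G}_{\phi_i}^{orlicz}(K_i).$$ Moreover, if $\vec\phi\in\widetilde{\Psi}^n$ and $m$ is an integer with $1\leq m\leq n$, then $$\big[\widetilde{\Omega}_{\vec\phi}^{orlicz}(\mathbf{K})\big]^m\leq\prod_{i=0}^{m-1}\widetilde{\Omega}^{orlicz}_{(\phi_1,\dots,\phi_{n-m},\phi_{n-i},\dots,\phi_{n-i})}(K_1,\dots,K_{n-m},\underbrace{K_{n-i},\dots,K_{n-i}}_{m}),$$ $$\big[\widetilde{G}_{\vec\phi}^{orlicz}(\mathbf{K})\big]^m\leq\prod_{i=0}^{m-1}\widetilde{G}^{orlicz}_{(\phi_1,\dots,\phi_{n-m},\phi_{n-i},\dots,\phi_{n-i})}(K_1,\dots,K_{n-m},\underbrace{K_{n-i},\dots,K_{n-i}}_{m}),$$ where in the subscripts $\phi_{n-i}$ is repeated $m$ times.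
   Context: $B_2^n$ is the closed unit Euclidean ball of $\mathbb{R}^n$, $S^{n-1}$ the unit sphere, $\sigma$ the spherical measure on $S^{n-1}$, $|\cdot|$ volume, $\omega_n=|B_2^n|$. A compact set $K$ that contains the closed segment from the origin to each of its points has radial function $\rho_K(u)=\max\{\lambda:\lambda u\in K\}$, $u\in S^{n-1}$; $K$ is a star body (about the origin) if $\rho_K$ is continuous and positive on $S^{n-1}$. $\mathcal{S}_0$ is the set of star bodies and $\mathcal{K}_0\subset\mathcal{S}_0$ the set of convex bodies with the origin in their interiors. For $K\in\mathcal{S}_0$ the polar body is $K^\circ=\{y:\langle x,y\rangle\leq1\ \forall x\in K\}$. $\mathcal{K}_c$ is the set of $K\in\mathcal{K}_0$ with centroid at the origin, $\mathcal{K}_s$ the set of $K\in\mathcal{K}_0$ with $K^\circ\in\mathcal{K}_c$; $\widetilde{\mathcal{K}}=\mathcal{K}_c\cup\mathcal{K}_s$ and $\widetilde{\mathcal{S}}=\{L\in\mathcal{S}_0: L^\circ\in\widetilde{\mathcal{K}}\}$. The volume radius is $\mathrm{vrad}(K)=(|K|/\omega_n)^{1/n}$. All functions $\phi,\phi_i:(0,\infty)\to(0,\infty)$ are continuous. $\widetilde{\Phi}$ is the set of $\phi$ for which $F(t)=\phi(t^{1/n})$ is either constant or strictly convex; $\widetilde{\Psi}$ the set of $\phi$ for which $F(t)=\phi(t^{1/n})$ is either constant or increasing and strictly concave. $\vec\phi\in\widetilde\Phi^n$ (resp. $\widetilde\Psi^n$) means each $\phi_i\in\widetilde\Phi$ (resp.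 each $\phi_i\in\widetilde\Psi$). Single body: for $K,L\in\mathcal{S}_0$, $\widetilde{V}_\phi(K,L)=\frac1n\int_{S^{n-1}}\phi\!\left(\frac{\rho_L(u)}{\rho_K(u)}\right)\rho_K(u)^n\,d\sigma(u)$. For $\phi\in\widetilde{\Phi}$, $\widetilde{\Omega}_{\phi}^{orlicz}(K)=\inf_{L\in\widetilde{\mathcal{S}}}\{n\widetilde{V}_\phi(K,\mathrm{vrad}(L^\circ)L)\}$ and $\widetilde{G}_{\phi}^{orlicz}(K)=\inf_{L\in\widetilde{\mathcal{K}}}\{n\widetilde{V}_\phi(K,\mathrm{vrad}(L^\circ)L)\}$; for $\phi\in\widetilde{\Psi}$, replace $\inf$ by $\sup$. Several bodies: for $\mathbf{K}=(K_1,\dots,K_n),\mathbf{L}=(L_1,\dots,L_n)\in\mathcal{S}_0^n$, $$\widetilde{V}_{\vec\phi}(\mathbf{K};\mathbf{L})=\frac1n\int_{S^{n-1}}\prod_{i=1}^n\left[\phi_i\!\left(\frac{\rho_{L_i}(u)}{\rho_{K_i}(u)}\right)\rho_{K_i}(u)^n\right]^{1/n}d\sigma(u).$$ For $\vec\phi\in\widetilde\Phi^n$, $\widetilde{\Omega}_{\vec\phi}^{orlicz}(\mathbf{K})$ is the infimum of $n\widetilde{V}_{\vec\phi}(\mathbf{K};\mathbf{L})$ over $\mathbf{L}\in\widetilde{\mathcal{S}}^n$ with $|L_1^\circ|=\dots=|L_n^\circ|=\omega_n$, and $\widetilde{G}_{\vec\phi}^{orlicz}(\mathbf{K})$ is the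 infimum of the same quantity over $\mathbf{L}\in\widetilde{\mathcal{K}}^n$ with $|L_1^\circ|=\dots=|L_n^\circ|=\omega_n$. For $\vec\phi\in\widetilde\Psi^n$, replace the infima by suprema. *)

theory Defs
  imports "HOL-Analysis.Analysis"
begin

text \<open>
  The ambient space is \<open>real ^ 'n\<close>, with \<open>n = CARD('n)\<close>. Tuples indexed by \<open>1, \<dots>, n\<close> are functions
  on \<^typ>\<open>nat\<close> of which only the values on \<open>{1..n}\<close> matter. Functions \<open>(0, \<infinity>) \<rightarrow> (0, \<infinity>)\<close> are
  functions on \<^typ>\<open>real\<close> of which only the values on \<open>{0<..}\<close> matter.
\<close>

abbreviation vol :: "(real ^ 'n) set \<Rightarrow> real" where
  "vol K \<equiv> measure lborel K"

abbreviation unit_ball :: "(real ^ 'n) set" where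
  "unit_ball \<equiv> cball 0 1"

text \<open>
  The unnormalised spherical Lebesgue measure on the unit sphere: \<open>\<sigma>(A)\<close> is \<open>n\<close> times the volume of
  the cone \<open>{t u | 0 < t \<le> 1, u \<in> A}\<close>. Note that \<open>sgn x = x / \<parallel>x\<parallel>\<close>.
\<close>

definition sphere_measure :: "(real ^ 'n) measure" where
  "sphere_measure = scale_measure (of_nat CARD('n))
     (distr (restrict_space lborel (unit_ball - {0})) (restrict_space borel (sphere 0 1)) sgn)"

lemma space_sphere_measure: "space sphere_measure = sphere 0 1"
  by (simp add: sphere_measure_def space_scale_measure space_restrict_space)

lemma sets_sphere_measure: "sets sphere_measure = sets (restrict_space borel (sphere 0 1))"
  by (simp add: sphere_measure_def)

lemma emeasure_sphere_measure:
  fixes A :: "(real ^ 'n) set"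
  assumes "A \<in> sets (restrict_space borel (sphere 0 1))"
  shows "emeasure sphere_measure A
    = of_nat CARD('n) * emeasure lborel {x \<in> unit_ball - {0}. sgn x \<in> A}"
proof -
  let ?B = "unit_ball - {0 :: real ^ 'n}"
  have "(\<lambda>x. x /\<^sub>R norm x) \<in> borel_measurable (borel :: (real ^ 'n) measure)"
    by measurable
  then have "sgn \<in> borel_measurable (borel :: (real ^ 'n) measure)"
    by (simp add: sgn_div_norm[abs_def])
  then have m: "sgn \<in> measurable (restrict_space lborel ?B) (restrict_space borel (sphere 0 1))"
    by (intro measurable_restrict_space3) (auto simp: norm_sgn)
  have eq: "sgn -` A \<inter> space (restrict_space lborel ?B) = {x \<in> ?B. sgn x \<in> A}"
    by (auto simp: space_restrict_space)
  have "emeasure (restrict_space lborel ?B) {x \<in> ?B. sgn x \<in> A}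
      = emeasure lborel {x \<in> ?B. sgn x \<in> A}"
    by (rule emeasure_restrict_space) auto
  then show ?thesis
    unfolding sphere_measure_def emeasure_scale_measure emeasure_distr[OF m assms] eq by (rule arg_cong)
qed

lemma emeasure_sphere_measure_total:
  "emeasure sphere_measure (sphere 0 1 :: (real ^ 'n) set)
    = of_nat CARD('n) * emeasure lborel (unit_ball :: (real ^ 'n) set)"
proof -
  have "sphere (0 :: real ^ 'n) 1 \<in> sets (restrict_space borel (sphere 0 1))"
    by (simp add: sets_restrict_space_iff)
  moreover have "{x \<in> unit_ball - {0 :: real ^ 'n}. sgn x \<in> sphere 0 1} = unit_ball - {0}"
    by (auto simp: norm_sgn)
  moreover have "emeasure lborel (unit_ball - {0 :: real ^ 'n}) = emeasure lborel (unit_ball :: (real ^ 'n) set)"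
    by (rule emeasure_Diff_null_set) (auto simp: null_sets_def)
  ultimately show ?thesis
    by (simp add: emeasure_sphere_measure)
qed


definition radial :: "(real ^ 'n) set \<Rightarrow> real ^ 'n \<Rightarrow> real" where
  "radial K u = (GREATEST r. r *\<^sub>R u \<in> K)"

text \<open>The condition \<open>K \<noteq> {}\<close> excludes the degenerate case in which \<^const>\<open>radial\<close> is unspecified.\<close>

definition star_bodies :: "(real ^ 'n) set set" where
  "star_bodies = {K. compact K \<and> K \<noteq> {} \<and> (\<forall>x\<in>K. closed_segment 0 x \<subseteq> K) \<and>
     continuous_on (sphere 0 1) (radial K) \<and> (\<forall>u\<in>sphere 0 1. 0 < radial K u)}"

definition convex_bodies :: "(real ^ 'n) set set" where
  "convex_bodies = {K. compact K \<and> convex K \<and> 0 \<in> interior K}"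

definition polar_body :: "(real ^ 'n) set \<Rightarrow> (real ^ 'n) set" where
  "polar_body K = {y. \<forall>x\<in>K. x \<bullet> y \<le> 1}"

definition centroid :: "(real ^ 'n) set \<Rightarrow> real ^ 'n" where
  "centroid K = (1 / vol K) *\<^sub>R (LINT x:K|lborel. x)"

definition centred_bodies :: "(real ^ 'n) set set" where
  "centred_bodies = {K \<in> convex_bodies. centroid K = 0}"

definition santalo_bodies :: "(real ^ 'n) set set" where
  "santalo_bodies = {K \<in> convex_bodies. polar_body K \<in> centred_bodies}"

definition K_tilde :: "(real ^ 'n) set set" where
  "K_tilde = centred_bodies \<union> santalo_bodies"

definition S_tilde :: "(real ^ 'n) set set" where
  "S_tilde = {L \<in> star_bodies. polar_body L \<in> K_tilde}"

definition vrad :: "(real ^ 'n) set \<Rightarrow> real" where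
  "vrad K = (vol K / vol (unit_ball :: (real ^ 'n) set)) powr (1 / CARD('n))"


definition strictly_convex_on :: "real set \<Rightarrow> (real \<Rightarrow> real) \<Rightarrow> bool" where
  "strictly_convex_on S f \<longleftrightarrow> convex S \<and>
     (\<forall>x\<in>S. \<forall>y\<in>S. \<forall>t. x \<noteq> y \<longrightarrow> 0 < t \<longrightarrow> t < 1 \<longrightarrow>
        f ((1 - t) * x + t * y) < (1 - t) * f x + t * f y)"

definition strictly_concave_on :: "real set \<Rightarrow> (real \<Rightarrow> real) \<Rightarrow> bool" where
  "strictly_concave_on S f \<longleftrightarrow> strictly_convex_on S (\<lambda>x. - f x)"

definition pos_continuous :: "(real \<Rightarrow> real) \<Rightarrow> bool" where
  "pos_continuous \<phi> \<longleftrightarrow> continuous_on {0<..} \<phi> \<and> (\<forall>t>0. 0 < \<phi> t)"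

definition Phi_tilde :: "nat \<Rightarrow> (real \<Rightarrow> real) set" where
  "Phi_tilde n = {\<phi>. pos_continuous \<phi> \<and>
     (let F = (\<lambda>t. \<phi> (t powr (1 / n)))
      in F constant_on {0<..} \<or> strictly_convex_on {0<..} F)}"

definition Psi_tilde :: "nat \<Rightarrow> (real \<Rightarrow> real) set" where
  "Psi_tilde n = {\<phi>. pos_continuous \<phi> \<and>
     (let F = (\<lambda>t. \<phi> (t powr (1 / n)))
      in F constant_on {0<..} \<or> mono_on {0<..} F \<and> strictly_concave_on {0<..} F)}"


definition dual_V :: "(real \<Rightarrow> real) \<Rightarrow> (real ^ 'n) set \<Rightarrow> (real ^ 'n) set \<Rightarrow> real" where
  "dual_V \<phi> K L = 1 / CARD('n) *
     (LINT u|sphere_measure. \<phi> (radial L u / radial K u) * radial K u ^ CARD('n))"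

definition dual_V_vec ::
  "(nat \<Rightarrow> real \<Rightarrow> real) \<Rightarrow> (nat \<Rightarrow> (real ^ 'n) set) \<Rightarrow> (nat \<Rightarrow> (real ^ 'n) set) \<Rightarrow> real" where
  "dual_V_vec \<phi> K L = 1 / CARD('n) *
     (LINT u|sphere_measure. (\<Prod>i=1..CARD('n).
        (\<phi> i (radial (L i) u / radial (K i) u) * radial (K i) u ^ CARD('n)) powr (1 / CARD('n))))"

text \<open>
  The infima and suprema are taken in \<open>[0, \<infinity>]\<close>; all the quantities involved are nonnegative, so the
  embedding \<^const>\<open>ennreal\<close> loses nothing. \<open>\<L>\<close> is the class of bodies the extremum ranges over.

  The classes \<^const>\<open>Phi_tilde\<close> and \<^const>\<open>Psi_tilde\<close> have only the constant functions in common.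
  For those the functional does not depend on \<open>L\<close>, so infimum and supremum agree and it does not
  matter which one is used. The \<open>else\<close> branches are meant for \<^const>\<open>Psi_tilde\<close>.
\<close>

definition orlicz_extremum ::
  "(real ^ 'n) set set \<Rightarrow> (real \<Rightarrow> real) \<Rightarrow> (real ^ 'n) set \<Rightarrow> ennreal" where
  "orlicz_extremum \<L> \<phi> K =
     (let v = (\<lambda>L. ennreal (CARD('n) * dual_V \<phi> K ((*\<^sub>R) (vrad (polar_body L)) ` L)))
      in if \<phi> \<in> Phi_tilde CARD('n) then (INF L\<in>\<L>. v L) else (SUP L\<in>\<L>. v L))"

definition orlicz_extremum_vec ::
  "(real ^ 'n) set set \<Rightarrow> (nat \<Rightarrow> real \<Rightarrow> real) \<Rightarrow> (nat \<Rightarrow> (real ^ 'n) set) \<Rightarrow> ennreal" where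
  "orlicz_extremum_vec \<L> \<phi> K =
     (let v = (\<lambda>L. ennreal (CARD('n) * dual_V_vec \<phi> K L));
          A = {L. \<forall>i\<in>{1..CARD('n)}. L i \<in> \<L> \<and>
                 vol (polar_body (L i)) = vol (unit_ball :: (real ^ 'n) set)}
      in if \<forall>i\<in>{1..CARD('n)}. \<phi> i \<in> Phi_tilde CARD('n)
         then (INF L\<in>A. v L) else (SUP L\<in>A. v L))"

definition Omega_orlicz :: "(real \<Rightarrow> real) \<Rightarrow> (real ^ 'n) set \<Rightarrow> ennreal" where
  "Omega_orlicz = orlicz_extremum S_tilde"

definition G_orlicz :: "(real \<Rightarrow> real) \<Rightarrow> (real ^ 'n) set \<Rightarrow> ennreal" where
  "G_orlicz = orlicz_extremum K_tilde"

definition Omega_orlicz_vec ::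
  "(nat \<Rightarrow> real \<Rightarrow> real) \<Rightarrow> (nat \<Rightarrow> (real ^ 'n) set) \<Rightarrow> ennreal" where
  "Omega_orlicz_vec = orlicz_extremum_vec S_tilde"

definition G_orlicz_vec ::
  "(nat \<Rightarrow> real \<Rightarrow> real) \<Rightarrow> (nat \<Rightarrow> (real ^ 'n) set) \<Rightarrow> ennreal" where
  "G_orlicz_vec = orlicz_extremum_vec K_tilde"

text \<open>The tuple \<open>(a\<^sub>1, \<dots>, a\<^bsub>n-m\<^esub>, a\<^bsub>n-i\<^esub>, \<dots>, a\<^bsub>n-i\<^esub>)\<close> of length \<open>n\<close>.\<close>

definition repeat_last :: "nat \<Rightarrow> nat \<Rightarrow> nat \<Rightarrow> (nat \<Rightarrow> 'a) \<Rightarrow> nat \<Rightarrow> 'a" where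
  "repeat_last n m i a = (\<lambda>j. if j \<le> n - m then a j else a (n - i))"

end

theory Submission
  imports Defs
begin

text \<open>
  For a fixed tuple \<open>L\<close> both kinds of inequality are instances of the generalised Hoelder inequality
  \<open>(\<integral> \<Prod> h\<^sub>i\<^bsup>1/m\<^esup>)\<^sup>m \<le> \<Prod> \<integral> h\<^sub>i\<close> on the sphere: with \<open>m = n\<close> and \<open>h\<^sub>i\<close> the integrands of the single bodies,
  respectively with \<open>h\<^sub>i\<close> the integrands of the tuples whose last \<open>m\<close> entries are repeated. Suprema
  are then immediate. For infima, a body \<open>L\<close> in the admissible class is replaced by \<open>vrad(L\<degree>) L\<close>,
  which is again in the class and whose polar body has the volume of the unit ball; so the bodies
  can be chosen independently of each other, each nearly optimal for its own factor.
\<close>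

subsection \<open>Star bodies, convex bodies and dilations\<close>

lemma radial_eqI:
  assumes "s *\<^sub>R u \<in> K" "\<And>r. r *\<^sub>R u \<in> K \<Longrightarrow> r \<le> s"
  shows "radial K u = s"
  unfolding radial_def using assms by (intro Greatest_equality) auto

text \<open>Shows that the \<open>GREATEST\<close> in \<open>radial\<close> is attained: the
  admissible \<open>r\<close> form a closed set containing 0, which is bounded because
  \<open>u \<noteq> 0\<close>.\<close>

lemma radial_greatest:
  fixes K :: "(real ^ 'n) set"
  assumes "compact K" "0 \<in> K" "u \<noteq> 0"
  shows "radial K u *\<^sub>R u \<in> K" and "\<And>r. r *\<^sub>R u \<in> K \<Longrightarrow> r \<le> radial K u"
proof -
  let ?R = "{r. r *\<^sub>R u \<in> K}"
  have "closed ((\<lambda>r. r *\<^sub>R u) -` K)"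
    using assms by (intro continuous_closed_vimage compact_imp_closed) (auto intro!: continuous_intros)
  then have "closed ?R"
    by (simp add: vimage_def)
  moreover obtain B where B: "\<And>x. x \<in> K \<Longrightarrow> norm x \<le> B"
    using assms compact_imp_bounded bounded_iff by metis
  have "\<bar>r\<bar> \<le> B / norm u" if "r \<in> ?R" for r
    using B[of "r *\<^sub>R u"] that assms by (simp add: field_simps)
  then have "bounded ?R"
    by (auto simp: bounded_iff)
  ultimately have "compact ?R"
    by (simp add: compact_eq_bounded_closed)
  moreover have "0 \<in> ?R"
    using assms by simp
  ultimately obtain s where s: "s \<in> ?R" "\<And>r. r \<in> ?R \<Longrightarrow> r \<le> s"
    using compact_attains_sup[of ?R] by blast
  then have "radial K u = s"
    by (intro radial_eqI) auto
  with s show "radial K u *\<^sub>R u \<in> K" "\<And>r. r *\<^sub>R u \<in> K \<Longrightarrow> r \<le> radial K u"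
    by auto
qed

lemma star_bodies_zero_mem: "K \<in> star_bodies \<Longrightarrow> 0 \<in> K"
  by (auto simp: star_bodies_def)

lemma mem_scaleR_image_iff:
  fixes K :: "'a::real_vector set"
  assumes "c \<noteq> 0"
  shows "x \<in> (*\<^sub>R) c ` K \<longleftrightarrow> (1 / c) *\<^sub>R x \<in> K"
  using assms by (force simp: image_iff)

lemma radial_scaleR:
  fixes K :: "(real ^ 'n) set"
  assumes "compact K" "0 \<in> K" "u \<noteq> 0" "c > 0"
  shows "radial ((*\<^sub>R) c ` K) u = c * radial K u"
proof (rule radial_eqI)
  show "(c * radial K u) *\<^sub>R u \<in> (*\<^sub>R) c ` K"
    using radial_greatest(1)[OF assms(1-3)] by (force simp: image_iff)
  fix r
  assume "r *\<^sub>R u \<in> (*\<^sub>R) c ` K"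
  then have "(r / c) *\<^sub>R u \<in> K"
    using \<open>c > 0\<close> by (simp add: mem_scaleR_image_iff)
  then have "r / c \<le> radial K u"
    by (rule radial_greatest(2)[OF assms(1-3)])
  then show "r \<le> c * radial K u"
    using \<open>c > 0\<close> by (simp add: field_simps)
qed

lemma star_bodies_scaleR:
  fixes K :: "(real ^ 'n) set"
  assumes K: "K \<in> star_bodies" and c: "c > 0"
  shows "(*\<^sub>R) c ` K \<in> star_bodies"
proof -
  have K': "compact K" "0 \<in> K" "\<And>x. x \<in> K \<Longrightarrow> closed_segment 0 x \<subseteq> K"
    "continuous_on (sphere 0 1) (radial K)" "\<And>u. u \<in> sphere 0 1 \<Longrightarrow> 0 < radial K u"
    using K star_bodies_zero_mem[OF K] by (auto simp: star_bodies_def)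
  have r: "radial ((*\<^sub>R) c ` K) u = c * radial K u" if "u \<in> sphere 0 1" for u
    using K' c that by (intro radial_scaleR) auto
  have "continuous_on (sphere 0 1) (\<lambda>u. c * radial K u)"
    by (intro continuous_intros K')
  then have "continuous_on (sphere 0 1) (radial ((*\<^sub>R) c ` K))"
    by (rule continuous_on_eq) (simp add: r)
  moreover have "closed_segment 0 y \<subseteq> (*\<^sub>R) c ` K" if y: "y \<in> (*\<^sub>R) c ` K" for y
  proof -
    obtain x where "x \<in> K" "y = c *\<^sub>R x"
      using y by blast
    then have "closed_segment 0 y = (*\<^sub>R) c ` closed_segment 0 x"
      using closed_segment_linear_image[of "(*\<^sub>R) c" 0 x] by (simp add: linear_scaleR)
    then show ?thesis
      using K'(3)[OF \<open>x \<in> K\<close>] by auto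
  qed
  moreover have "compact ((*\<^sub>R) c ` K)"
    using K'(1) by (rule compact_scaling)
  ultimately show ?thesis
    using r K' c by (auto simp: star_bodies_def)
qed

lemma convex_bodies_scaleR:
  fixes K :: "(real ^ 'n) set"
  assumes K: "K \<in> convex_bodies" and c: "c > 0"
  shows "(*\<^sub>R) c ` K \<in> convex_bodies"
proof -
  have "inj ((*\<^sub>R) c :: real ^ 'n \<Rightarrow> real ^ 'n)"
    using c by (auto simp: inj_on_def)
  then have "interior ((*\<^sub>R) c ` K) = (*\<^sub>R) c ` interior K"
    using interior_injective_linear_image[of "(*\<^sub>R) c" K] by (simp add: linear_scaleR)
  then show ?thesis
    using K by (auto simp: convex_bodies_def compact_scaling convex_scaling image_iff intro!: bexI[of _ 0])
qed

section \<open>Polar body, volume and centroid under dilations\<close>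

lemma polar_body_scaleR:
  fixes K :: "(real ^ 'n) set"
  assumes "c > 0"
  shows "polar_body ((*\<^sub>R) c ` K) = (*\<^sub>R) (1 / c) ` polar_body K"
  using assms by (auto simp: polar_body_def mem_scaleR_image_iff)

lemma borel_scaleR_image:
  fixes K :: "(real ^ 'n) set"
  assumes "K \<in> sets borel" "c \<noteq> 0"
  shows "(*\<^sub>R) c ` K \<in> sets borel"
proof -
  have "(*\<^sub>R) c ` K = (\<lambda>x. (1 / c) *\<^sub>R x) -` K"
    using assms by (auto simp: mem_scaleR_image_iff)
  moreover have "(\<lambda>x::real^'n. (1 / c) *\<^sub>R x) \<in> borel_measurable borel"
    by measurable
  ultimately show ?thesis
    using assms(1) by (simp only: measurable_sets_borel)
qed

lemma vol_scaleR:
  fixes K :: "(real ^ 'n) set"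
  assumes "K \<in> sets borel" "c > 0"
  shows "vol ((*\<^sub>R) c ` K) = c ^ CARD('n) * vol K"
proof -
  have m: "(*\<^sub>R) c ` K \<in> sets borel"
    using assms by (intro borel_scaleR_image) simp_all
  have "emeasure lborel ((*\<^sub>R) c ` K) = ennreal (c ^ CARD('n)) * emeasure lborel K"
  proof -
    have v: "(\<lambda>x. c *\<^sub>R x) -` ((*\<^sub>R) c ` K) = K"
      using assms by auto
    \<comment> \<open>\<open>lborel_affine\<close> presents \<open>lborel\<close> as its own image
      under \<open>x \<mapsto> c x\<close> with constant density \<open>c ^ CARD('n)\<close>; the
      preimage of the dilate is \<open>K\<close>.\<close>
    show ?thesis
      using assms m
      by (subst lborel_affine[of c 0])
        (simp_all add: emeasure_density nn_integral_cmult emeasure_distr v flip: ennreal_power)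
  qed
  then show ?thesis
    using assms by (simp add: measure_def enn2real_mult)
qed

text \<open>The substitution contributes the Jacobian \<open>c ^ CARD('n)\<close> and the integrand
  one more factor \<open>c\<close>; division by the volume of the dilate cancels the
  Jacobian.\<close>

lemma centroid_scaleR:
  fixes K :: "(real ^ 'n) set"
  assumes "K \<in> sets borel" "c > 0"
  shows "centroid ((*\<^sub>R) c ` K) = c *\<^sub>R centroid K"
proof -
  have m: "(*\<^sub>R) c ` K \<in> sets borel"
    using assms by (intro borel_scaleR_image) simp_all
  have i: "indicator ((*\<^sub>R) c ` K) (c *\<^sub>R x) = (indicator K x :: real)" for x
    using assms by (auto simp: indicator_def)
  have [measurable]: "(\<lambda>x. indicator ((*\<^sub>R) c ` K) x *\<^sub>R x) \<in> borel_measurable borel"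
    using m by measurable
  have "(LINT x:(*\<^sub>R) c ` K|lborel. x)
      = c ^ CARD('n) *\<^sub>R (LINT x|lborel. indicator ((*\<^sub>R) c ` K) (c *\<^sub>R x) *\<^sub>R c *\<^sub>R x)"
    unfolding set_lebesgue_integral_def using assms
    by (subst lborel_affine[of c 0], simp)
      (subst integral_density, simp_all add: integral_distr del: indicator_image scaleR_scaleR)
  also have "\<dots> = c ^ CARD('n) *\<^sub>R c *\<^sub>R (LINT x:K|lborel. x)"
    unfolding i set_lebesgue_integral_def
    by (subst integral_scaleR_right[symmetric]) (simp add: mult.commute)
  finally show ?thesis
    using assms by (simp add: centroid_def vol_scaleR)
qed

lemma convex_bodies_borel: "K \<in> convex_bodies \<Longrightarrow> K \<in> sets borel"
  by (auto simp: convex_bodies_def intro: borel_compact)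

lemma centred_bodies_scaleR:
  "K \<in> centred_bodies \<Longrightarrow> c > 0 \<Longrightarrow> (*\<^sub>R) c ` K \<in> centred_bodies"
  by (auto simp: centred_bodies_def convex_bodies_scaleR centroid_scaleR convex_bodies_borel)

text \<open>A centroid at the origin survives every dilation, and dilating by \<open>c\<close>
  dilates the polar body by \<open>1 / c\<close>; hence both constituents of the class are
  preserved.\<close>

lemma K_tilde_scaleR:
  "K \<in> K_tilde \<Longrightarrow> c > 0 \<Longrightarrow> (*\<^sub>R) c ` K \<in> K_tilde"
  by (auto simp: K_tilde_def santalo_bodies_def centred_bodies_scaleR convex_bodies_scaleR
      polar_body_scaleR)

lemma S_tilde_scaleR:
  "K \<in> S_tilde \<Longrightarrow> c > 0 \<Longrightarrow> (*\<^sub>R) c ` K \<in> S_tilde"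
  by (auto simp: S_tilde_def star_bodies_scaleR K_tilde_scaleR polar_body_scaleR)

section \<open>Convex bodies: polarity, positive volume, continuity of the radial function\<close>

text \<open>The polar body is an intersection of closed half-spaces. A ball of radius
  \<open>e\<close> inside \<open>K\<close> bounds it by \<open>1 / e\<close>, and a bound
  \<open>B\<close> for \<open>K\<close> puts a ball of radius \<open>1 / B\<close> inside
  it.\<close>

lemma polar_body_convex_bodies:
  fixes K :: "(real ^ 'n) set"
  assumes "K \<in> convex_bodies"
  shows "polar_body K \<in> convex_bodies"
proof -
  obtain e where e: "e > 0" "cball 0 e \<subseteq> K"
    using assms by (auto simp: convex_bodies_def mem_interior_cball)
  obtain B where B: "B > 0" "\<And>x. x \<in> K \<Longrightarrow> norm x \<le> B"
    using assms compact_imp_bounded[of K] by (auto simp: convex_bodies_def bounded_pos)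
  have eq: "polar_body K = (\<Inter>x\<in>K. {y. x \<bullet> y \<le> 1})"
    by (auto simp: polar_body_def)
  have "closed (polar_body K)" "convex (polar_body K)"
    unfolding eq by (auto intro!: closed_INT convex_INT closed_halfspace_le convex_halfspace_le)
  moreover have "norm y \<le> 1 / e" if "y \<in> polar_body K" for y
  proof -
    \<comment> \<open>Testing \<open>y\<close> against the point of the inner ball in its own
      direction turns the polar inequality into a bound on \<open>norm y\<close>.\<close>
    have "e *\<^sub>R sgn y \<in> K"
      using e by (intro subsetD[OF e(2)]) (simp add: norm_sgn)
    then have "e *\<^sub>R sgn y \<bullet> y \<le> 1"
      using that unfolding polar_body_def by blast
    moreover have "e *\<^sub>R sgn y \<bullet> y = e * norm y"
      by (cases "y = 0") (simp_all add: sgn_div_norm dot_square_norm power2_eq_square)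
    ultimately show ?thesis
      using e by (simp add: field_simps)
  qed
  then have "bounded (polar_body K)"
    by (auto simp: bounded_iff)
  moreover have "cball 0 (1 / B) \<subseteq> polar_body K"
  proof
    fix y :: "real ^ 'n"
    assume y: "y \<in> cball 0 (1 / B)"
    have "x \<bullet> y \<le> 1" if "x \<in> K" for x
    proof -
      have "x \<bullet> y \<le> norm x * norm y"
        by (rule norm_cauchy_schwarz)
      also have "\<dots> \<le> B * (1 / B)"
        using B that y by (intro mult_mono) auto
      finally show ?thesis
        using B by simp
    qed
    then show "y \<in> polar_body K"
      by (simp add: polar_body_def)
  qed
  then have "0 \<in> interior (polar_body K)"
    using B by (auto simp: mem_interior_cball intro!: exI[of _ "1 / B"])
  ultimately show ?thesis
    by (simp add: convex_bodies_def compact_eq_bounded_closed)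
qed

lemma vol_convex_body_pos:
  assumes "K \<in> convex_bodies"
  shows "vol K > 0"
proof -
  obtain e where e: "e > 0" "cball 0 e \<subseteq> K"
    using assms by (auto simp: convex_bodies_def mem_interior_cball)
  have "0 < vol (cball 0 e :: (real ^ 'a) set)"
    using e by (simp add: content_cball_pos)
  also have "\<dots> \<le> vol K"
    using assms e(2)
    by (intro measure_mono_fmeasurable)
      (auto simp: convex_bodies_def intro: fmeasurable_compact)
  finally show ?thesis .
qed

text \<open>The graph of the radial function is \<open>{(u, r). r \<ge> 0, r u \<in> \<partial>K}\<close>, hence closed.\<close>

lemma convex_bodies_subset_star_bodies:
  "(convex_bodies :: (real ^ 'n) set set) \<subseteq> star_bodies"
proof
  fix K :: "(real ^ 'n) set"
  assume K: "K \<in> convex_bodies"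
  then have cK: "compact K" "convex K" "0 \<in> interior K"
    by (auto simp: convex_bodies_def)
  then have z: "0 \<in> K"
    using interior_subset by auto
  obtain e where e: "e > 0" "cball 0 e \<subseteq> K"
    using cK by (auto simp: mem_interior_cball)
  obtain B where B: "\<And>x. x \<in> K \<Longrightarrow> norm x \<le> B"
    using cK compact_imp_bounded bounded_iff by metis
  let ?S = "sphere 0 1 :: (real ^ 'n) set"
  have g: "radial K u *\<^sub>R u \<in> K" "\<And>r. r *\<^sub>R u \<in> K \<Longrightarrow> r \<le> radial K u" if "u \<in> ?S" for u
    using radial_greatest[OF cK(1) z, of u] that by fastforce+
  have ge: "radial K u \<ge> e" if "u \<in> ?S" for u
    using e that by (intro g(2)[OF that] subsetD[OF e(2)]) auto
  have pos: "radial K u > 0" if "u \<in> ?S" for u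
    using ge[OF that] e by linarith
  \<comment> \<open>If the last point of \<open>K\<close> on the ray were interior, the ray would
    stay in \<open>K\<close> a little longer. Conversely, the points strictly between the interior
    point 0 and that last point are interior, so no other boundary point lies on the ray.\<close>
  have front: "radial K u = r \<longleftrightarrow> 0 \<le> r \<and> r *\<^sub>R u \<in> frontier K" if u: "u \<in> ?S" for u r
  proof
    assume r: "radial K u = r"
    have "r *\<^sub>R u \<notin> interior K"
    proof
      assume "r *\<^sub>R u \<in> interior K"
      then obtain d where d: "d > 0" "cball (r *\<^sub>R u) d \<subseteq> K"
        by (auto simp: mem_interior_cball)
      have "(r + d) *\<^sub>R u \<in> cball (r *\<^sub>R u) d"
        using d u by (simp add: dist_norm algebra_simps)
      then have "(r + d) *\<^sub>R u \<in> K"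
        using d by auto
      then show False
        using g(2)[OF u] r d by fastforce
    qed
    then show "0 \<le> r \<and> r *\<^sub>R u \<in> frontier K"
      using pos[OF u] r g(1)[OF u] closure_subset by (auto simp: frontier_def)
  next
    assume r: "0 \<le> r \<and> r *\<^sub>R u \<in> frontier K"
    then have "r *\<^sub>R u \<in> K" "r *\<^sub>R u \<notin> interior K"
      using cK by (auto simp: frontier_def compact_imp_closed)
    then have le: "r \<le> radial K u"
      using g(2)[OF u] by auto
    show "radial K u = r"
    proof (rule ccontr)
      assume "radial K u \<noteq> r"
      with le have lt: "r < radial K u" by simp
      have "r \<noteq> 0"
        using \<open>r *\<^sub>R u \<notin> interior K\<close> cK by auto
      then have "r > 0"
        using r by auto
      have "r *\<^sub>R u \<in> open_segment 0 (radial K u *\<^sub>R u)"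
        unfolding in_segment
        using u lt \<open>r > 0\<close> by (auto intro!: exI[of _ "r / radial K u"])
      moreover have "open_segment 0 (radial K u *\<^sub>R u) \<subseteq> interior K"
        using cK g(1)[OF u] closure_subset by (intro in_interior_closure_convex_segment) auto
      ultimately show False
        using \<open>r *\<^sub>R u \<notin> interior K\<close> by auto
    qed
  qed
  have "continuous_on ?S (radial K)"
  \<comment> \<open>A function into a compact set is continuous once its graph is closed; the norm
    bound \<open>B\<close> supplies the compact interval.\<close>
  proof (rule continuous_from_closed_graph[of "{0..B}"])
    show "radial K \<in> ?S \<rightarrow> {0..B}"
      using pos g(1) B by (fastforce simp: less_imp_le)
    have "(\<lambda>u. (u, radial K u)) ` ?S
        = (?S \<times> {0..}) \<inter> (\<lambda>p. snd p *\<^sub>R fst p) -` frontier K"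
      (is "?G = ?F")
    proof (intro set_eqI iffI)
      fix p
      assume "p \<in> ?G"
      then show "p \<in> ?F"
        using front by fastforce
    next
      fix p
      assume "p \<in> ?F"
      then have "fst p \<in> ?S" "radial K (fst p) = snd p"
        using front[of "fst p" "snd p"] by auto
      then show "p \<in> ?G"
        by (intro image_eqI[of _ _ "fst p"]) auto
    qed
    moreover have "closed \<dots>"
      by (intro closed_Int closed_Times continuous_closed_vimage) (auto intro!: continuous_intros)
    ultimately show "closed ((\<lambda>u. (u, radial K u)) ` ?S)"
      by simp
  qed auto
  then show "K \<in> star_bodies"
    using cK z pos by (auto simp: star_bodies_def dest: closed_segment_subset)
qed

subsection \<open>Hoelder's inequality for dual mixed volumes\<close>

text \<open>Hoelder for \<open>card I\<close> factors with equal exponents. If some factor has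
  integral 0, it vanishes almost everywhere and so does the product. Otherwise each factor is
  divided by its integral, the inequality of arithmetic and geometric means is applied pointwise,
  and the resulting average integrates to 1.\<close>

lemma holder_prod:
  fixes h :: "'i \<Rightarrow> 'a \<Rightarrow> real"
  assumes I: "finite I" "I \<noteq> {}"
    and int: "\<And>i. i \<in> I \<Longrightarrow> integrable M (h i)"
    and nonneg: "\<And>i x. i \<in> I \<Longrightarrow> 0 \<le> h i x"
  shows "(LINT x|M. (\<Prod>i\<in>I. h i x) powr (1 / card I)) ^ card I \<le> (\<Prod>i\<in>I. LINT x|M. h i x)"
proof -
  define J where "J i = (LINT x|M. h i x)" for i
  let ?m = "card I"
  have m: "?m > 0"
    using I by (simp add: card_gt_0_iff)
  have J: "J i \<ge> 0" if "i \<in> I" for i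
    using nonneg[OF that] by (simp add: J_def)
  show ?thesis
  proof (cases "\<exists>i\<in>I. J i = 0")
    case True
    then obtain i where i: "i \<in> I" "J i = 0" by auto
    have "AE x in M. h i x = 0"
      using i int nonneg integral_nonneg_eq_0_iff_AE[of M "h i"] by (auto simp: J_def)
    then have "AE x in M. (\<Prod>i\<in>I. h i x) powr (1 / ?m) = 0"
      using i I by (auto elim!: eventually_mono)
    then have "(LINT x|M. (\<Prod>i\<in>I. h i x) powr (1 / ?m)) = 0"
      by (rule integral_eq_zero_AE)
    then show ?thesis
      using J m by (simp add: J_def prod_nonneg power_0_left)
  next
    case False
    with J have Jpos: "J i > 0" if "i \<in> I" for i
      using that by force
    \<comment> \<open>The geometric mean of the integrals, pulled out so that the remaining factors
      \<open>h i x / J i\<close> all have integral 1.\<close>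
    define C where "C = (\<Prod>i\<in>I. J i) powr (1 / ?m)"
    have le: "(\<Prod>i\<in>I. h i x) powr (1 / ?m) \<le> C * (\<Sum>i\<in>I. h i x / J i / ?m)" for x
    proof -
      have "(\<Prod>i\<in>I. h i x) = (\<Prod>i\<in>I. J i) * (\<Prod>i\<in>I. h i x / J i)"
        using Jpos by (subst prod.distrib[symmetric], intro prod.cong) force+
      then have "(\<Prod>i\<in>I. h i x) powr (1 / ?m) = C * (\<Prod>i\<in>I. h i x / J i) powr (1 / ?m)"
        using J nonneg by (simp add: C_def powr_mult prod_nonneg)
      also have "\<dots> \<le> C * (\<Sum>i\<in>I. h i x / J i / ?m)"
        using J nonneg I
        by (intro mult_left_mono arith_geom_mean) (auto simp: C_def)
      finally show ?thesis .
    qed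
    \<comment> \<open>\<open>integral_mono'\<close> asks for integrability of the larger function
      only: if the smaller one is not integrable, its integral is 0 by convention.\<close>
    have "(LINT x|M. (\<Prod>i\<in>I. h i x) powr (1 / ?m))
        \<le> (LINT x|M. C * (\<Sum>i\<in>I. h i x / J i / ?m))"
      using le nonneg J int
      by (intro integral_mono') (auto intro!: sum_nonneg mult_nonneg_nonneg simp: C_def)
    also have "\<dots> = C * (\<Sum>i\<in>I. (LINT x|M. h i x) / J i / ?m)"
      using int by simp
    also have "(\<Sum>i\<in>I. (LINT x|M. h i x) / J i / ?m) = (\<Sum>i\<in>I. 1 / ?m)"
      using Jpos by (intro sum.cong) (force simp flip: J_def)+
    also have "\<dots> = 1"
      using m by simp
    finally have "(LINT x|M. (\<Prod>i\<in>I. h i x) powr (1 / ?m)) \<le> C"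
      by simp
    then have "(LINT x|M. (\<Prod>i\<in>I. h i x) powr (1 / ?m)) ^ ?m \<le> C ^ ?m"
      by (intro power_mono) simp_all
    also have "C ^ ?m = C powr ?m"
      using m Jpos by (intro powr_realpow[symmetric]) (simp add: C_def prod_pos less_imp_neq[symmetric] I)
    also have "\<dots> = (\<Prod>i\<in>I. J i)"
      using m J by (simp add: C_def powr_powr prod_nonneg)
    finally show ?thesis
      by (simp add: J_def)
  qed
qed

text \<open>Each of the \<open>m\<close> tuples contributes the product of the first
  \<open>n - m\<close> entries and the \<open>m\<close>-th power of \<open>b (n - i)\<close>. As
  \<open>i\<close> runs through \<open>0, ..., m - 1\<close>, the index \<open>n - i\<close> runs
  once through the last \<open>m\<close> positions.\<close>

lemma prod_repeat_last:
  fixes b :: "nat \<Rightarrow> 'a::comm_semiring_1"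
  assumes "m \<le> n"
  shows "(\<Prod>i=0..<m. \<Prod>j=1..n. repeat_last n m i b j) = (\<Prod>j=1..n. b j) ^ m"
proof -
  have split: "{1..n} = {1..n - m} \<union> {n - m + 1..n}"
    using assms by auto
  have s: "(\<Prod>j=1..n. f j) = (\<Prod>j=1..n - m. f j) * (\<Prod>j=n - m + 1..n. f j)" for f :: "nat \<Rightarrow> 'a"
    unfolding split by (rule prod.union_disjoint) auto
  have "(\<Prod>j=1..n. repeat_last n m i b j) = (\<Prod>j=1..n - m. b j) * b (n - i) ^ m" for i
  proof -
    have "(\<Prod>j=n - m + 1..n. repeat_last n m i b j) = (\<Prod>j=n - m + 1..n. b (n - i))"
      by (intro prod.cong) (auto simp: repeat_last_def)
    then show ?thesis
      using assms unfolding s by (simp add: repeat_last_def)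
  qed
  moreover have "(\<Prod>i=0..<m. b (n - i)) = (\<Prod>j=n - m + 1..n. b j)"
    using assms by (intro prod.reindex_bij_witness[of _ "\<lambda>j. n - j" "\<lambda>i. n - i"]) auto
  ultimately show ?thesis
    unfolding s[of b] by (simp add: prod.distrib power_mult_distrib flip: prod_power_distrib)
qed

text \<open>For finite \<open>c\<close> the bound on the powers becomes a bound on \<open>f\<close>
  itself by taking \<open>m\<close>-th roots; it then passes to the supremum and is raised to the
  power \<open>m\<close> again.\<close>

lemma SUP_power_le_ennreal:
  fixes f :: "'a \<Rightarrow> ennreal"
  assumes "m > 0" "\<And>x. x \<in> A \<Longrightarrow> f x ^ m \<le> c"
  shows "(SUP x\<in>A. f x) ^ m \<le> c"
proof (cases c)
  case (real r)
  have "f x \<le> ennreal (root m r)" if "x \<in> A" for x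
  proof (cases "f x")
    case (real s)
    then have "s ^ m \<le> r"
      using assms(2)[OF that] \<open>c = ennreal r\<close> \<open>0 \<le> r\<close> by (simp add: ennreal_power)
    then have "root m (s ^ m) \<le> root m r"
      using assms by simp
    then show ?thesis
      using real assms by (simp add: real_root_power_cancel ennreal_leI)
  next
    case top
    then show ?thesis
      using assms(2)[OF that] \<open>c = ennreal r\<close> \<open>m > 0\<close> by (simp add: power_eq_top_ennreal top_unique)
  qed
  then have "(SUP x\<in>A. f x) ^ m \<le> ennreal (root m r) ^ m"
    by (intro power_mono SUP_least) auto
  then show ?thesis
    using real assms by (simp add: ennreal_power)
qed simp

section \<open>Continuous integrands on the sphere and the dual mixed volumes\<close>

lemma integrable_sphere_measure:
  fixes f :: "real ^ 'n \<Rightarrow> real"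
  assumes "continuous_on (sphere 0 1) f"
  shows "integrable sphere_measure f"
proof -
  have "emeasure sphere_measure (space (sphere_measure :: (real ^ 'n) measure)) < \<infinity>"
    unfolding space_sphere_measure emeasure_sphere_measure_total
    using emeasure_lborel_cball_finite[of "0 :: real ^ 'n" 1]
    by (simp add: ennreal_mult_less_top of_nat_less_top)
  then interpret finite_measure "sphere_measure :: (real ^ 'n) measure"
    by (intro finite_measureI) simp
  have "bounded (f ` sphere 0 1)"
    using assms by (intro compact_imp_bounded compact_continuous_image) auto
  then obtain B where "\<And>x. x \<in> sphere 0 1 \<Longrightarrow> norm (f x) \<le> B"
    unfolding bounded_iff by blast
  moreover have "f \<in> borel_measurable sphere_measure"
    using borel_measurable_continuous_on_restrict[OF assms]
    by (simp only: measurable_cong_sets[OF sets_sphere_measure refl])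
  ultimately show ?thesis
    by (intro integrable_const_bound[of _ B]) (auto intro!: AE_I2 simp: space_sphere_measure)
qed

text \<open>Common to both functionals: \<open>dual_V\<close> integrates one such function,
  \<open>dual_V_vec\<close> the geometric mean of \<open>CARD('n)\<close> of them, which is the
  shape \<open>holder_prod\<close> expects.\<close>

definition dual_integrand ::
  "(real \<Rightarrow> real) \<Rightarrow> (real ^ 'n) set \<Rightarrow> (real ^ 'n) set \<Rightarrow> real ^ 'n \<Rightarrow> real" where
  "dual_integrand \<phi> K L u = \<phi> (radial L u / radial K u) * radial K u ^ CARD('n)"

lemma star_body_radial:
  assumes "K \<in> star_bodies"
  shows "continuous_on (sphere 0 1) (radial K)" "\<And>u. norm u = 1 \<Longrightarrow> radial K u > 0"
  using assms by (auto simp: star_bodies_def)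

lemma dual_integrand_pos:
  assumes "pos_continuous \<phi>" "K \<in> star_bodies" "L \<in> star_bodies" "norm u = 1"
  shows "dual_integrand \<phi> K L u > 0"
proof -
  have "radial K u > 0" "radial L u > 0"
    using assms star_body_radial(2) by blast+
  then show ?thesis
    using assms(1) by (simp add: dual_integrand_def pos_continuous_def)
qed

lemma continuous_on_dual_integrand:
  assumes \<phi>: "pos_continuous \<phi>" and K: "K \<in> star_bodies" and L: "L \<in> star_bodies"
  shows "continuous_on (sphere 0 1) (dual_integrand \<phi> K L)"
proof -
  have pos: "radial K u > 0" "radial L u > 0" if "u \<in> sphere 0 1" for u
    using that star_body_radial(2)[OF K] star_body_radial(2)[OF L] by simp_all
  have ratio: "continuous_on (sphere 0 1) (\<lambda>u. radial L u / radial K u)"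
    using pos(1) by (intro continuous_on_divide star_body_radial(1) K L) force
  have "continuous_on {0<..} \<phi>"
    using \<phi> by (simp add: pos_continuous_def)
  then have "continuous_on (sphere 0 1) (\<lambda>u. \<phi> (radial L u / radial K u))"
    using ratio
  proof (rule continuous_on_compose2)
    show "(\<lambda>u. radial L u / radial K u) ` sphere 0 1 \<subseteq> {0<..}"
      using pos by (intro image_subsetI) simp
  qed
  then show ?thesis
    unfolding dual_integrand_def[abs_def]
    by (intro continuous_on_mult continuous_on_power star_body_radial(1) K)
qed

lemma CARD_dual_V:
  fixes K :: "(real ^ 'n) set"
  shows "CARD('n) * dual_V \<phi> K L = (LINT u|sphere_measure. dual_integrand \<phi> K L u)"
  by (simp add: dual_V_def dual_integrand_def)

lemma CARD_dual_V_vec: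
  fixes K :: "nat \<Rightarrow> (real ^ 'n) set"
  shows "CARD('n) * dual_V_vec \<phi> K L = (LINT u|sphere_measure.
    (\<Prod>i=1..CARD('n). dual_integrand (\<phi> i) (K i) (L i) u powr (1 / CARD('n))))"
  by (simp add: dual_V_vec_def dual_integrand_def)

lemma dual_V_nonneg:
  fixes K L :: "(real ^ 'n) set"
  assumes "pos_continuous \<phi>" "K \<in> star_bodies" "L \<in> star_bodies"
  shows "0 \<le> CARD('n) * dual_V \<phi> K L"
  unfolding CARD_dual_V
  by (intro integral_nonneg_AE AE_I2 less_imp_le dual_integrand_pos[OF assms])
    (simp add: space_sphere_measure)

lemma dual_V_vec_nonneg:
  fixes K L :: "nat \<Rightarrow> (real ^ 'n) set"
  shows "0 \<le> CARD('n) * dual_V_vec \<phi> K L"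
  unfolding CARD_dual_V_vec by (intro integral_nonneg_AE AE_I2 prod_nonneg ballI powr_ge_zero)

lemma dual_V_vec_power_le:
  fixes K L :: "nat \<Rightarrow> (real ^ 'n) set"
  assumes "\<forall>i\<in>{1..CARD('n)}. pos_continuous (\<phi> i) \<and> K i \<in> star_bodies \<and> L i \<in> star_bodies"
  shows "(CARD('n) * dual_V_vec \<phi> K L) ^ CARD('n)
    \<le> (\<Prod>i=1..CARD('n). CARD('n) * dual_V (\<phi> i) (K i) (L i))"
proof -
  let ?M = "sphere_measure :: (real ^ 'n) measure"
  \<comment> \<open>\<open>holder_prod\<close> wants nonnegativity at every point of the space,
    whereas the integrand is known to be positive only on the sphere. Truncation changes nothing
    there.\<close>
  define h where "h i u = max 0 (dual_integrand (\<phi> i) (K i) (L i) u)" for i u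
  have h: "h i u = dual_integrand (\<phi> i) (K i) (L i) u" if "i \<in> {1..CARD('n)}" "u \<in> space ?M" for i u
    using dual_integrand_pos[of "\<phi> i" "K i" "L i" u] assms that
    by (auto simp: h_def space_sphere_measure)
  have "integrable ?M (h i)" if "i \<in> {1..CARD('n)}" for i
    unfolding h_def[abs_def] using assms that
    by (intro integrable_sphere_measure continuous_intros continuous_on_dual_integrand) auto
  from holder_prod[of "{1..CARD('n)}" ?M h, OF _ _ this]
  have "(LINT u|?M. (\<Prod>i=1..CARD('n). h i u) powr (1 / CARD('n))) ^ CARD('n)
      \<le> (\<Prod>i=1..CARD('n). LINT u|?M. h i u)"
    by (simp add: h_def)
  also have "(\<Prod>i=1..CARD('n). LINT u|?M. h i u) = (\<Prod>i=1..CARD('n). CARD('n) * dual_V (\<phi> i) (K i) (L i))"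
    unfolding CARD_dual_V by (intro prod.cong refl Bochner_Integration.integral_cong h)
  also have "(LINT u|?M. (\<Prod>i=1..CARD('n). h i u) powr (1 / CARD('n))) = CARD('n) * dual_V_vec \<phi> K L"
    unfolding CARD_dual_V_vec
  proof (intro Bochner_Integration.integral_cong refl)
    fix u :: "real ^ 'n"
    assume u: "u \<in> space ?M"
    have "(\<Prod>i=1..CARD('n). h i u) powr (1 / CARD('n)) = (\<Prod>i=1..CARD('n). h i u powr (1 / CARD('n)))"
      by (rule prod_powr_distrib)
    also have "\<dots> = (\<Prod>i=1..CARD('n). dual_integrand (\<phi> i) (K i) (L i) u powr (1 / CARD('n)))"
      by (rule prod.cong) (simp_all add: h[OF _ u])
    finally show "(\<Prod>i=1..CARD('n). h i u) powr (1 / CARD('n))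
        = (\<Prod>i=1..CARD('n). dual_integrand (\<phi> i) (K i) (L i) u powr (1 / CARD('n)))" .
  qed
  finally show ?thesis .
qed

text \<open>Hoelder with \<open>m\<close> factors, the \<open>i\<close>-th being the integrand of
  the \<open>i\<close>-th repeated tuple. By \<open>prod_repeat_last\<close> their geometric mean is
  the original integrand.\<close>

lemma dual_V_vec_power_le_repeat_last:
  fixes K L :: "nat \<Rightarrow> (real ^ 'n) set"
  assumes pc: "\<forall>i\<in>{1..CARD('n)}. pos_continuous (\<phi> i) \<and> K i \<in> star_bodies \<and> L i \<in> star_bodies"
    and m: "1 \<le> m" "m \<le> CARD('n)"
  shows "(CARD('n) * dual_V_vec \<phi> K L) ^ m
    \<le> (\<Prod>i=0..<m. CARD('n) * dual_V_vec (repeat_last CARD('n) m i \<phi>)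
          (repeat_last CARD('n) m i K) (repeat_last CARD('n) m i L))"
proof -
  let ?n = "CARD('n)"
  let ?M = "sphere_measure :: (real ^ 'n) measure"
  define b where "b j u = dual_integrand (\<phi> j) (K j) (L j) u powr (1 / ?n)" for j u
  \<comment> \<open>The repetition is applied to the roots \<open>b j u\<close> so that
    \<open>prod_repeat_last\<close> fits; this agrees with repeating functions and bodies
    separately.\<close>
  define h where "h i u = (\<Prod>j=1..?n. repeat_last ?n m i (\<lambda>j. b j u) j)" for i u
  have b0: "0 \<le> b j u" for j u
    by (simp add: b_def)
  then have h0: "0 \<le> h i u" for i u
    unfolding h_def by (intro prod_nonneg) (simp add: repeat_last_def)
  have cb: "continuous_on (sphere 0 1) (b j)" if "j \<in> {1..?n}" for j
    unfolding b_def[abs_def] using pc that dual_integrand_pos[of "\<phi> j" "K j" "L j"]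
    by (intro continuous_intros continuous_on_dual_integrand) force+
  have "integrable ?M (h i)" if "i \<in> {0..<m}" for i
  proof (rule integrable_sphere_measure)
    have "continuous_on (sphere 0 1) (\<lambda>u. repeat_last ?n m i (\<lambda>j. b j u) j)" if "j \<in> {1..?n}" for j
      \<comment> \<open>Beyond position \<open>n - m\<close> the entry is the one at
        \<open>n - i\<close>, a valid index because \<open>i < m\<close> and
        \<open>m \<le> n\<close>.\<close>
      using cb[OF that] cb[of "?n - i"] \<open>i \<in> {0..<m}\<close> m
      by (cases "j \<le> ?n - m") (auto simp: repeat_last_def)
    then show "continuous_on (sphere 0 1) (h i)"
      unfolding h_def[abs_def] by (intro continuous_on_prod) auto
  qed
  from holder_prod[of "{0..<m}" ?M h, OF _ _ this h0]
  have "(LINT u|?M. (\<Prod>i=0..<m. h i u) powr (1 / m)) ^ m \<le> (\<Prod>i=0..<m. LINT u|?M. h i u)"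
    using m by simp
  moreover have "(\<Prod>i=0..<m. h i u) powr (1 / m) = (\<Prod>j=1..?n. b j u)" for u
  proof -
    have "(\<Prod>i=0..<m. h i u) = (\<Prod>j=1..?n. b j u) ^ m"
      unfolding h_def using m by (intro prod_repeat_last)
    then show ?thesis
      using m b0 by (simp add: powr_powr prod_nonneg flip: powr_realpow')
  qed
  moreover have "h i u = (\<Prod>j=1..?n. dual_integrand (repeat_last ?n m i \<phi> j) (repeat_last ?n m i K j)
      (repeat_last ?n m i L j) u powr (1 / ?n))" for i u
    unfolding h_def b_def repeat_last_def by (intro prod.cong refl) simp
  ultimately show ?thesis
    unfolding CARD_dual_V_vec b_def by simp
qed

subsection \<open>Orlicz extrema\<close>

lemma Phi_tilde_pos_continuous: "\<phi> \<in> Phi_tilde n \<Longrightarrow> pos_continuous \<phi>"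
  by (simp add: Phi_tilde_def)

lemma Psi_tilde_pos_continuous: "\<phi> \<in> Psi_tilde n \<Longrightarrow> pos_continuous \<phi>"
  by (simp add: Psi_tilde_def)

text \<open>If \<open>?F\<close> were not constant, it would be both strictly convex and strictly
  concave, which is contradictory at the midpoint of 1 and 2. Needed because the extrema of such
  functions are defined as infima even where a supremum is wanted.\<close>

lemma Phi_Psi_tilde_constant:
  assumes "\<phi> \<in> Phi_tilde n" "\<phi> \<in> Psi_tilde n" "n > 0"
  obtains c where "\<And>t. t > 0 \<Longrightarrow> \<phi> t = c"
proof -
  let ?F = "\<lambda>t. \<phi> (t powr (1 / n))"
  have midpoint: "G (3 / 2) < G 1 / 2 + G 2 / 2" if G: "strictly_convex_on {0<..} G" for G
  proof -
    have "G ((1 - 1 / 2) * 1 + 1 / 2 * 2) < (1 - 1 / 2) * G 1 + 1 / 2 * G 2"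
      using G[unfolded strictly_convex_on_def, THEN conjunct2, rule_format, of 1 2 "1 / 2"] by simp
    then show ?thesis
      by simp
  qed
  have "?F constant_on {0<..}"
  proof (rule ccontr)
    assume "\<not> ?F constant_on {0<..}"
    then have "strictly_convex_on {0<..} ?F" "strictly_convex_on {0<..} (\<lambda>t. - ?F t)"
      using assms by (auto simp: Phi_tilde_def Psi_tilde_def strictly_concave_on_def Let_def)
    then have "?F (3 / 2) < ?F 1 / 2 + ?F 2 / 2" "- ?F (3 / 2) < - ?F 1 / 2 + - ?F 2 / 2"
      using midpoint by blast+
    then show False
      by simp
  qed
  then obtain c where c: "\<And>t. t > 0 \<Longrightarrow> ?F t = c"
    by (auto simp: constant_on_def)
  have "\<phi> t = c" if "t > 0" for t
    \<comment> \<open>The argument \<open>t powr n\<close> undoes the power \<open>1 / n\<close> in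
      \<open>?F\<close>.\<close>
    using c[of "t powr n"] that assms by (simp add: powr_powr)
  then show ?thesis
    by (rule that)
qed

text \<open>Collects what the arguments use of \<open>S_tilde\<close> and \<open>K_tilde\<close>, so
  that both are treated at once: positive radial functions, polar bodies of positive finite volume,
  and closure under the normalising dilations.\<close>

definition admissible_class :: "(real ^ 'n) set set \<Rightarrow> bool" where
  "admissible_class \<L> \<longleftrightarrow> (\<forall>L\<in>\<L>. L \<in> star_bodies \<and> polar_body L \<in> convex_bodies \<and>
     (\<forall>c>0. (*\<^sub>R) c ` L \<in> \<L>))"

lemma K_tilde_subset_convex_bodies: "K_tilde \<subseteq> convex_bodies"
  by (auto simp: K_tilde_def centred_bodies_def santalo_bodies_def)

lemma admissible_class_K_tilde: "admissible_class K_tilde"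
  using K_tilde_subset_convex_bodies convex_bodies_subset_star_bodies polar_body_convex_bodies
    K_tilde_scaleR unfolding admissible_class_def by blast

lemma admissible_class_S_tilde: "admissible_class S_tilde"
  unfolding admissible_class_def
proof (intro ballI conjI allI impI)
  fix L :: "(real ^ 'n) set"
  assume L: "L \<in> S_tilde"
  then show "L \<in> star_bodies" "polar_body L \<in> convex_bodies"
    using K_tilde_subset_convex_bodies by (auto simp: S_tilde_def)
  show "(*\<^sub>R) c ` L \<in> S_tilde" if "c > 0" for c
    using L that by (rule S_tilde_scaleR)
qed

lemma vol_unit_ball_pos: "vol (unit_ball :: (real ^ 'n) set) > 0"
  by (simp add: content_cball_pos)

text \<open>Dilating \<open>L\<close> by \<open>c\<close> divides the volume of its polar body by
  \<open>c ^ CARD('n)\<close>, and for \<open>c = vrad (polar_body L)\<close> this power is the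
  ratio of that volume to the volume of the unit ball.\<close>

lemma vrad_polar_normalise:
  fixes L :: "(real ^ 'n) set"
  assumes "polar_body L \<in> convex_bodies"
  shows "vrad (polar_body L) > 0"
    and "vol (polar_body ((*\<^sub>R) (vrad (polar_body L)) ` L)) = vol (unit_ball :: (real ^ 'n) set)"
proof -
  let ?c = "vrad (polar_body L)"
  let ?\<omega> = "vol (unit_ball :: (real ^ 'n) set)"
  have vp: "vol (polar_body L) > 0"
    using assms by (rule vol_convex_body_pos)
  have q: "vol (polar_body L) / ?\<omega> > 0"
    using vp vol_unit_ball_pos[where 'n = 'n] by (rule divide_pos_pos)
  then show c: "?c > 0"
    by (simp only: vrad_def powr_gt_zero)
  have "?c ^ CARD('n) = ?c powr CARD('n)"
    using c by (simp add: powr_realpow)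
  also have "\<dots> = vol (polar_body L) / ?\<omega>"
    using q by (simp add: vrad_def powr_powr)
  finally have cn: "?c ^ CARD('n) = vol (polar_body L) / ?\<omega>" .
  have "vol (polar_body ((*\<^sub>R) ?c ` L)) = (1 / ?c) ^ CARD('n) * vol (polar_body L)"
    using c convex_bodies_borel[OF assms] by (simp add: polar_body_scaleR vol_scaleR)
  also have "\<dots> = vol (polar_body L) / (vol (polar_body L) / ?\<omega>)"
    by (simp add: power_divide cn)
  also have "\<dots> = ?\<omega>"
    using vp by simp
  finally show "vol (polar_body ((*\<^sub>R) ?c ` L)) = ?\<omega>" .
qed

text \<open>
  A function lying in both classes is constant, so the functional does not depend on \<open>L\<close> and the
  infimum prescribed by the definition still dominates each of its values.
\<close>

lemma dual_V_le_orlicz_extremum: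
  fixes K :: "(real ^ 'n) set"
  assumes \<L>: "admissible_class \<L>" and \<phi>: "\<phi> \<in> Psi_tilde CARD('n)" and K: "K \<in> star_bodies"
    and L: "L \<in> \<L>"
  shows "ennreal (CARD('n) * dual_V \<phi> K ((*\<^sub>R) (vrad (polar_body L)) ` L)) \<le> orlicz_extremum \<L> \<phi> K"
proof (cases "\<phi> \<in> Phi_tilde CARD('n)")
  case True
  then obtain c where c: "\<And>t. t > 0 \<Longrightarrow> \<phi> t = c"
    using Phi_Psi_tilde_constant[OF True \<phi>] by auto
  have "CARD('n) * dual_V \<phi> K ((*\<^sub>R) (vrad (polar_body L)) ` L)
      = (LINT u|sphere_measure. c * radial K u ^ CARD('n))" if "L \<in> \<L>" for L
    unfolding CARD_dual_V
  proof (intro Bochner_Integration.integral_cong refl)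
    fix u :: "real ^ 'n"
    assume "u \<in> space sphere_measure"
    then have u: "norm u = 1"
      by (simp add: space_sphere_measure)
    have "(*\<^sub>R) (vrad (polar_body L)) ` L \<in> star_bodies"
      using \<L> that vrad_polar_normalise(1)[of L] unfolding admissible_class_def by blast
    then have "radial ((*\<^sub>R) (vrad (polar_body L)) ` L) u / radial K u > 0"
      using star_body_radial(2) K u by (metis divide_pos_pos)
    then show "dual_integrand \<phi> K ((*\<^sub>R) (vrad (polar_body L)) ` L) u = c * radial K u ^ CARD('n)"
      by (simp add: dual_integrand_def c)
  qed
  then show ?thesis
    using True L by (simp add: orlicz_extremum_def Let_def INF_greatest)
next
  case False
  then show ?thesis
    using L by (auto simp: orlicz_extremum_def Let_def intro!: SUP_upper)
qed

section \<open>Normalised tuples and bounds for the extrema\<close>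

definition normalised_tuples :: "(real ^ 'n) set set \<Rightarrow> (nat \<Rightarrow> (real ^ 'n) set) set" where
  "normalised_tuples \<L> = {L. \<forall>i\<in>{1..CARD('n)}. L i \<in> \<L> \<and>
     vol (polar_body (L i)) = vol (unit_ball :: (real ^ 'n) set)}"

lemma orlicz_extremum_vec_eq:
  fixes K :: "nat \<Rightarrow> (real ^ 'n) set"
  shows "orlicz_extremum_vec \<L> \<phi> K =
    (if \<forall>i\<in>{1..CARD('n)}. \<phi> i \<in> Phi_tilde CARD('n)
     then INF L\<in>normalised_tuples \<L>. ennreal (CARD('n) * dual_V_vec \<phi> K L)
     else SUP L\<in>normalised_tuples \<L>. ennreal (CARD('n) * dual_V_vec \<phi> K L))"
  unfolding orlicz_extremum_vec_def Let_def normalised_tuples_def ..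

text \<open>Clear for a supremum. The infimum is taken only if every \<open>\<phi> i\<close> is in
  both classes; then all of them are constant and the functional has the same value at every
  normalised tuple.\<close>

lemma dual_V_vec_le_orlicz_extremum_vec:
  fixes K :: "nat \<Rightarrow> (real ^ 'n) set"
  assumes \<L>: "\<L> \<subseteq> star_bodies"
    and \<phi>: "\<forall>i\<in>{1..CARD('n)}. \<phi> i \<in> Psi_tilde CARD('n)"
    and K: "\<forall>i\<in>{1..CARD('n)}. K i \<in> star_bodies"
    and L: "L \<in> normalised_tuples \<L>"
  shows "ennreal (CARD('n) * dual_V_vec \<phi> K L) \<le> orlicz_extremum_vec \<L> \<phi> K"
proof (cases "\<forall>i\<in>{1..CARD('n)}. \<phi> i \<in> Phi_tilde CARD('n)")
  case True
  have "\<forall>i\<in>{1..CARD('n)}. \<exists>c. \<forall>t>0. \<phi> i t = c"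
    using True \<phi> Phi_Psi_tilde_constant[where n = "CARD('n)"] by (metis zero_less_card_finite)
  then obtain c where c: "\<And>i t. i \<in> {1..CARD('n)} \<Longrightarrow> t > 0 \<Longrightarrow> \<phi> i t = c i"
    by metis
  have "CARD('n) * dual_V_vec \<phi> K L = (LINT u|sphere_measure.
      (\<Prod>i=1..CARD('n). (c i * radial (K i) u ^ CARD('n)) powr (1 / CARD('n))))"
    if "L \<in> normalised_tuples \<L>" for L
    unfolding CARD_dual_V_vec
  proof (intro Bochner_Integration.integral_cong prod.cong refl)
    fix u :: "real ^ 'n" and i
    assume u: "u \<in> space sphere_measure" and i: "i \<in> {1..CARD('n)}"
    then have u: "norm u = 1"
      by (simp add: space_sphere_measure)
    have "L i \<in> star_bodies" "K i \<in> star_bodies"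
      using \<L> that i K by (auto simp: normalised_tuples_def)
    then have "radial (L i) u / radial (K i) u > 0"
      using star_body_radial(2) u by (metis divide_pos_pos)
    then show "dual_integrand (\<phi> i) (K i) (L i) u powr (1 / CARD('n))
        = (c i * radial (K i) u ^ CARD('n)) powr (1 / CARD('n))"
      using c[OF i] by (simp add: dual_integrand_def)
  qed
  then show ?thesis
    using True L by (simp add: orlicz_extremum_vec_eq INF_greatest)
next
  case False
  then show ?thesis
    using L unfolding orlicz_extremum_vec_eq if_not_P[OF False] by (intro SUP_upper)
qed

text \<open>Over a nonempty set an infimum is at most the supremum, so in either branch a bound
  valid at every tuple is enough.\<close>

lemma orlicz_extremum_vec_power_le:
  fixes K :: "nat \<Rightarrow> (real ^ 'n) set"
  assumes "m > 0" "normalised_tuples \<L> \<noteq> ({} :: (nat \<Rightarrow> (real ^ 'n) set) set)"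
    and "\<And>L. L \<in> normalised_tuples \<L> \<Longrightarrow> ennreal (CARD('n) * dual_V_vec \<phi> K L) ^ m \<le> c"
  shows "orlicz_extremum_vec \<L> \<phi> K ^ m \<le> c"
proof -
  have "orlicz_extremum_vec \<L> \<phi> K
      \<le> (SUP L\<in>normalised_tuples \<L>. ennreal (CARD('n) * dual_V_vec \<phi> K L))"
    unfolding orlicz_extremum_vec_eq using assms(2) by (auto intro!: INF_le_SUP)
  then have "orlicz_extremum_vec \<L> \<phi> K ^ m
      \<le> (SUP L\<in>normalised_tuples \<L>. ennreal (CARD('n) * dual_V_vec \<phi> K L)) ^ m"
    by (intro power_mono) auto
  also have "\<dots> \<le> c"
    using assms by (intro SUP_power_le_ennreal) auto
  finally show ?thesis .
qed

text \<open>The points \<open>x i\<close> are chosen independently, each within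
  \<open>1 / Suc k\<close> of its infimum, and \<open>k\<close> tends to infinity. The infima are
  finite because \<open>A\<close> is nonempty and the values are real, so the limit can be taken in
  the reals.\<close>

lemma le_prod_ennreal_INF:
  fixes f :: "'i \<Rightarrow> 'a \<Rightarrow> real"
  assumes A: "A \<noteq> {}"
    and le: "\<And>x. (\<And>i. i \<in> I \<Longrightarrow> x i \<in> A) \<Longrightarrow> c \<le> (\<Prod>i\<in>I. ennreal (f i (x i)))"
  shows "c \<le> (\<Prod>i\<in>I. INF x\<in>A. ennreal (f i x))"
proof -
  define X where "X i = enn2real (INF x\<in>A. ennreal (f i x))" for i
  have fin: "(INF x\<in>A. ennreal (f i x)) \<noteq> \<infinity>" for i
    using A by (metis INF_lower ennreal_neq_top ex_in_conv infinity_ennreal_def neq_top_trans)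
  then have X: "(INF x\<in>A. ennreal (f i x)) = ennreal (X i)" "0 \<le> X i" for i
    unfolding X_def infinity_ennreal_def by (metis ennreal_enn2real top.not_eq_extremum) simp
  have "c \<le> ennreal (\<Prod>i\<in>I. X i + 1 / Suc k)" for k
  proof -
    have "\<exists>x\<in>A. ennreal (f i x) < ennreal (X i) + ennreal (1 / Suc k)" for i
      using fin[of i] X(1)[of i] by (intro INF_approx_ennreal) auto
    then obtain x where x: "\<And>i. x i \<in> A" "\<And>i. ennreal (f i (x i)) < ennreal (X i) + ennreal (1 / Suc k)"
      by metis
    have "c \<le> (\<Prod>i\<in>I. ennreal (f i (x i)))"
      using x by (intro le)
    also have "\<dots> \<le> (\<Prod>i\<in>I. ennreal (X i + 1 / Suc k))"
      using x X(2) by (intro prod_mono_ennreal) (simp add: less_imp_le)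
    also have "\<dots> = ennreal (\<Prod>i\<in>I. X i + 1 / Suc k)"
      using X(2) by (intro prod_ennreal) simp
    finally show ?thesis .
  qed
  moreover have "(\<lambda>k. ennreal (\<Prod>i\<in>I. X i + 1 / Suc k)) \<longlonglongrightarrow> ennreal (\<Prod>i\<in>I. X i + 0)"
    by (intro tendsto_ennrealI tendsto_prod tendsto_add tendsto_const LIMSEQ_Suc lim_1_over_n)
  ultimately have "c \<le> ennreal (\<Prod>i\<in>I. X i + 0)"
    by (intro LIMSEQ_le_const) auto
  then show ?thesis
    using X by (simp add: prod_ennreal)
qed

section \<open>Comparison with the product of the single-body extrema\<close>

lemma orlicz_extremum_vec_power_le_prod:
  fixes K :: "nat \<Rightarrow> (real ^ 'n) set"
  assumes \<L>: "admissible_class \<L>"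
    and K: "\<forall>i\<in>{1..CARD('n)}. K i \<in> star_bodies"
    and \<phi>: "(\<forall>i\<in>{1..CARD('n)}. \<phi> i \<in> Phi_tilde CARD('n)) \<or>
         (\<forall>i\<in>{1..CARD('n)}. \<phi> i \<in> Psi_tilde CARD('n))"
  shows "orlicz_extremum_vec \<L> \<phi> K ^ CARD('n) \<le> (\<Prod>i=1..CARD('n). orlicz_extremum \<L> (\<phi> i) (K i))"
proof -
  have star: "L \<in> star_bodies" if "L \<in> \<L>" for L
    using \<L> that by (simp add: admissible_class_def)
  have pc: "pos_continuous (\<phi> i)" if "i \<in> {1..CARD('n)}" for i
    using \<phi> that Phi_tilde_pos_continuous Psi_tilde_pos_continuous by blast
  have holder: "ennreal (CARD('n) * dual_V_vec \<phi> K L) ^ CARD('n)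
      \<le> (\<Prod>i=1..CARD('n). ennreal (CARD('n) * dual_V (\<phi> i) (K i) (L i)))"
    if "L \<in> normalised_tuples \<L>" for L
  proof -
    have L: "\<forall>i\<in>{1..CARD('n)}. L i \<in> star_bodies"
      using that star by (simp add: normalised_tuples_def)
    then have "(\<Prod>i=1..CARD('n). ennreal (CARD('n) * dual_V (\<phi> i) (K i) (L i)))
        = ennreal (\<Prod>i=1..CARD('n). CARD('n) * dual_V (\<phi> i) (K i) (L i))"
      using pc K by (intro prod_ennreal dual_V_nonneg) auto
    moreover have "ennreal (CARD('n) * dual_V_vec \<phi> K L) ^ CARD('n)
        = ennreal ((CARD('n) * dual_V_vec \<phi> K L) ^ CARD('n))"
      by (rule ennreal_power[OF dual_V_vec_nonneg])
    moreover have "(CARD('n) * dual_V_vec \<phi> K L) ^ CARD('n)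
        \<le> (\<Prod>i=1..CARD('n). CARD('n) * dual_V (\<phi> i) (K i) (L i))"
      using pc K L by (intro dual_V_vec_power_le) blast
    ultimately show ?thesis
      by (simp only: ennreal_leI)
  qed
  define N where "N L = (*\<^sub>R) (vrad (polar_body L)) ` L" for L :: "(real ^ 'n) set"
  have N: "N L \<in> \<L>" "vol (polar_body (N L)) = vol (unit_ball :: (real ^ 'n) set)" if "L \<in> \<L>" for L
    using \<L> that vrad_polar_normalise[of L] unfolding admissible_class_def N_def by blast+
  show ?thesis
  \<comment> \<open>The split follows the test in \<open>orlicz_extremum_vec\<close>; when it fails,
    the assumption on \<open>\<phi>\<close> leaves only \<open>Psi_tilde\<close>.\<close>
  proof (cases "\<forall>i\<in>{1..CARD('n)}. \<phi> i \<in> Phi_tilde CARD('n)")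
    case True
    then have vec: "orlicz_extremum_vec \<L> \<phi> K
        = (INF L\<in>normalised_tuples \<L>. ennreal (CARD('n) * dual_V_vec \<phi> K L))"
      unfolding orlicz_extremum_vec_eq by (rule if_P)
    have single: "(\<Prod>i=1..CARD('n). orlicz_extremum \<L> (\<phi> i) (K i))
        = (\<Prod>i=1..CARD('n). INF L\<in>\<L>. ennreal (CARD('n) * dual_V (\<phi> i) (K i) (N L)))"
      using True by (intro prod.cong refl) (simp add: orlicz_extremum_def N_def)
    show ?thesis
    proof (cases "\<L> = {}")
      case True
      \<comment> \<open>Infima over the empty class are \<open>top\<close>, so the right hand side
        is \<open>top\<close>.\<close>
      then show ?thesis
        unfolding single by simp
    next
      case False
      show ?thesis
        unfolding single
      proof (rule le_prod_ennreal_INF[OF False])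
        fix L
        assume L: "\<And>i. i \<in> {1..CARD('n)} \<Longrightarrow> L i \<in> \<L>"
        then have L': "(\<lambda>i. N (L i)) \<in> normalised_tuples \<L>"
          using N by (simp add: normalised_tuples_def)
        then have "orlicz_extremum_vec \<L> \<phi> K \<le> ennreal (CARD('n) * dual_V_vec \<phi> K (\<lambda>i. N (L i)))"
          unfolding vec by (rule INF_lower)
        then have "orlicz_extremum_vec \<L> \<phi> K ^ CARD('n)
            \<le> ennreal (CARD('n) * dual_V_vec \<phi> K (\<lambda>i. N (L i))) ^ CARD('n)"
          by (intro power_mono) auto
        also have "\<dots> \<le> (\<Prod>i=1..CARD('n). ennreal (CARD('n) * dual_V (\<phi> i) (K i) (N (L i))))"
          using L' by (rule holder)
        finally show "orlicz_extremum_vec \<L> \<phi> K ^ CARD('n)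
            \<le> (\<Prod>i=1..CARD('n). ennreal (CARD('n) * dual_V (\<phi> i) (K i) (N (L i))))" .
      qed
    qed
  next
    case False
    show ?thesis
    proof (cases "normalised_tuples \<L> = ({} :: (nat \<Rightarrow> (real ^ 'n) set) set)")
      case True
      \<comment> \<open>The supremum over no tuples is 0 in \<open>ennreal\<close>.\<close>
      then have "orlicz_extremum_vec \<L> \<phi> K = 0"
        unfolding orlicz_extremum_vec_eq if_not_P[OF False] by (simp add: bot_ennreal)
      then show ?thesis
        by (simp add: power_0_left)
    next
      case ne: False
      show ?thesis
      proof (rule orlicz_extremum_vec_power_le[OF _ ne])
        fix L
        assume L: "L \<in> normalised_tuples \<L>"
        \<comment> \<open>Some \<open>\<phi> i\<close> may be constant, and its single-body extremum
          is then an infimum; \<open>dual_V_le_orlicz_extremum\<close> covers this too.\<close>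
        have "ennreal (CARD('n) * dual_V (\<phi> i) (K i) (L i)) \<le> orlicz_extremum \<L> (\<phi> i) (K i)"
          if i: "i \<in> {1..CARD('n)}" for i
        proof -
          have Li: "L i \<in> \<L>" "vol (polar_body (L i)) = vol (unit_ball :: (real ^ 'n) set)"
            using L i by (simp_all add: normalised_tuples_def)
          \<comment> \<open>For a normalised body the dilation inside \<open>orlicz_extremum\<close>
            is the identity.\<close>
          then have "vrad (polar_body (L i)) = 1"
            using vol_unit_ball_pos[where 'n = 'n] by (simp add: vrad_def)
          moreover have "\<phi> i \<in> Psi_tilde CARD('n)"
            using \<phi> False i by blast
          ultimately show ?thesis
            using dual_V_le_orlicz_extremum[OF \<L> _ _ Li(1), of "\<phi> i" "K i"] K i by simp
        qed
        then show "ennreal (CARD('n) * dual_V_vec \<phi> K L) ^ CARD('n)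
            \<le> (\<Prod>i=1..CARD('n). orlicz_extremum \<L> (\<phi> i) (K i))"
          by (intro order_trans[OF holder[OF L]] prod_mono_ennreal)
      qed simp
    qed
  qed
qed

section \<open>Comparison with the extrema of repeated tuples\<close>

lemma repeat_last_mem:
  assumes "\<forall>j\<in>{1..n}. a j \<in> S" "i < m" "m \<le> n"
  shows "\<forall>j\<in>{1..n}. repeat_last n m i a j \<in> S"
  using assms by (auto simp: repeat_last_def)

text \<open>The factors on the right of the integral inequality all use bodies of one tuple
  \<open>L\<close>, so they cannot be optimised separately; each is instead bounded above by its
  extremum. Repeating entries of a normalised tuple gives a normalised tuple.\<close>

lemma orlicz_extremum_vec_power_le_repeat_last:
  fixes K :: "nat \<Rightarrow> (real ^ 'n) set"
  assumes \<L>: "\<L> \<subseteq> star_bodies"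
    and K: "\<forall>i\<in>{1..CARD('n)}. K i \<in> star_bodies"
    and \<phi>: "\<forall>i\<in>{1..CARD('n)}. \<phi> i \<in> Psi_tilde CARD('n)"
    and m: "1 \<le> m" "m \<le> CARD('n)"
  shows "orlicz_extremum_vec \<L> \<phi> K ^ m
    \<le> (\<Prod>i=0..<m. orlicz_extremum_vec \<L> (repeat_last CARD('n) m i \<phi>) (repeat_last CARD('n) m i K))"
proof (cases "normalised_tuples \<L> = ({} :: (nat \<Rightarrow> (real ^ 'n) set) set)")
  case empty: True
  show ?thesis
  proof (cases "\<forall>i\<in>{1..CARD('n)}. \<phi> i \<in> Phi_tilde CARD('n)")
    case True
    \<comment> \<open>The repeated functions stay in \<open>Phi_tilde\<close>, so every factor is an
      infimum over the empty set.\<close>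
    have "orlicz_extremum_vec \<L> (repeat_last CARD('n) m i \<phi>) (repeat_last CARD('n) m i K) = top"
      if "i \<in> {0..<m}" for i
      using repeat_last_mem[OF True, of i m] that m
      by (simp add: orlicz_extremum_vec_eq empty)
    then show ?thesis
      using m by simp
  next
    case False
    then have "orlicz_extremum_vec \<L> \<phi> K = 0"
      unfolding orlicz_extremum_vec_eq if_not_P[OF False] empty by (simp add: bot_ennreal)
    then show ?thesis
      using m by (simp add: power_0_left)
  qed
next
  case ne: False
  show ?thesis
  proof (rule orlicz_extremum_vec_power_le[OF _ ne])
    fix L
    assume L: "L \<in> normalised_tuples \<L>"
    let ?R = "\<lambda>i. dual_V_vec (repeat_last CARD('n) m i \<phi>) (repeat_last CARD('n) m i K)
      (repeat_last CARD('n) m i L)"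
    have "\<forall>i\<in>{1..CARD('n)}. pos_continuous (\<phi> i) \<and> K i \<in> star_bodies \<and> L i \<in> star_bodies"
      using L \<L> K \<phi> Psi_tilde_pos_continuous by (auto simp: normalised_tuples_def)
    then have "(CARD('n) * dual_V_vec \<phi> K L) ^ m \<le> (\<Prod>i=0..<m. CARD('n) * ?R i)"
      using m by (rule dual_V_vec_power_le_repeat_last)
    then have "ennreal (CARD('n) * dual_V_vec \<phi> K L) ^ m \<le> ennreal (\<Prod>i=0..<m. CARD('n) * ?R i)"
      unfolding ennreal_power[OF dual_V_vec_nonneg] by (rule ennreal_leI)
    also have "\<dots> = (\<Prod>i=0..<m. ennreal (CARD('n) * ?R i))"
      by (rule prod_ennreal[symmetric]) (rule dual_V_vec_nonneg)
    also have "\<dots> \<le> (\<Prod>i=0..<m. orlicz_extremum_vec \<L> (repeat_last CARD('n) m i \<phi>) (repeat_last CARD('n) m i K))"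
    proof (intro prod_mono_ennreal dual_V_vec_le_orlicz_extremum_vec \<L>)
      fix i
      assume "i \<in> {0..<m}"
      then have i: "i < m"
        by simp
      show "\<forall>j\<in>{1..CARD('n)}. repeat_last CARD('n) m i \<phi> j \<in> Psi_tilde CARD('n)"
        "\<forall>j\<in>{1..CARD('n)}. repeat_last CARD('n) m i K j \<in> star_bodies"
        using repeat_last_mem[OF \<phi> i m(2)] repeat_last_mem[OF K i m(2)] by auto
      show "repeat_last CARD('n) m i L \<in> normalised_tuples \<L>"
        \<comment> \<open>Membership and normalisation together form a condition on single entries,
          so they are passed on as one set.\<close>
        using repeat_last_mem[of "CARD('n)" L "{L \<in> \<L>. vol (polar_body L) = vol (unit_ball :: (real ^ 'n) set)}", OF _ i m(2)] L
        unfolding normalised_tuples_def by simp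
    qed
    finally show "ennreal (CARD('n) * dual_V_vec \<phi> K L) ^ m \<le> \<dots>" .
  qed (use m in simp)
qed

theorem theorem5p1:
  fixes K :: "nat \<Rightarrow> (real ^ 'n) set" and \<phi> :: "nat \<Rightarrow> real \<Rightarrow> real"
  assumes "\<forall>i\<in>{1..CARD('n)}. K i \<in> star_bodies"
    and "(\<forall>i\<in>{1..CARD('n)}. \<phi> i \<in> Phi_tilde CARD('n)) \<or>
         (\<forall>i\<in>{1..CARD('n)}. \<phi> i \<in> Psi_tilde CARD('n))"
  shows "Omega_orlicz_vec \<phi> K ^ CARD('n) \<le> (\<Prod>i=1..CARD('n). Omega_orlicz (\<phi> i) (K i)) \<and>
    G_orlicz_vec \<phi> K ^ CARD('n) \<le> (\<Prod>i=1..CARD('n). G_orlicz (\<phi> i) (K i)) \<and>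
    ((\<forall>i\<in>{1..CARD('n)}. \<phi> i \<in> Psi_tilde CARD('n)) \<longrightarrow>
      (\<forall>m. 1 \<le> m \<and> m \<le> CARD('n) \<longrightarrow>
        Omega_orlicz_vec \<phi> K ^ m
          \<le> (\<Prod>i=0..<m. Omega_orlicz_vec (repeat_last CARD('n) m i \<phi>) (repeat_last CARD('n) m i K)) \<and>
        G_orlicz_vec \<phi> K ^ m
          \<le> (\<Prod>i=0..<m. G_orlicz_vec (repeat_last CARD('n) m i \<phi>) (repeat_last CARD('n) m i K))))"
proof -
  have "S_tilde \<subseteq> (star_bodies :: (real ^ 'n) set set)" "K_tilde \<subseteq> (star_bodies :: (real ^ 'n) set set)"
    using admissible_class_S_tilde admissible_class_K_tilde by (auto simp: admissible_class_def)
  then show ?thesis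
    unfolding Omega_orlicz_def G_orlicz_def Omega_orlicz_vec_def G_orlicz_vec_def
    using orlicz_extremum_vec_power_le_prod[OF admissible_class_S_tilde assms]
      orlicz_extremum_vec_power_le_prod[OF admissible_class_K_tilde assms]
      orlicz_extremum_vec_power_le_repeat_last[OF _ assms(1)]
    by blast
qed

end
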